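(* Let $p\in(0,1)$. For each integer $n\ge 1$ let $\eta^{(n)}$ be the final stable configuration obtained by stabilizing $n$ particles placed at the origin of $\mathbb{Z}$ with $p$-topplings, let $\mathtt{l}_n$ and $\mathtt{r}_n$ be its left and right boundary vertices, and set $\mathcal{S}_n:=[\mathtt{l}_n,\mathtt{r}_n]\cap\mathbb{Z}$. Then for every $\varepsilon>0$ $$\lim_{n\to\infty}\mathbb{P}\Big(\big[-\tfrac{n}{2}(1-\varepsilon),\tfrac{n}{2}(1-\varepsilon)\big]\cap\mathbb{Z}\subseteq \mathcal{S}_n\subseteq \big[-\tfrac{n}{2}(1+\varepsilon),\tfrac{n}{2}(1+\varepsilon)\big]\cap\mathbb{Z}\Big)=1.$$
   Context: $\mathbb{N}=\{0,1,2,\dots\}$. A sandpile configuration is a function $\eta:\mathbb{Z}\to\mathbb{N}$; $\eta(v)$ is the number of particles at $v$. A vertex $v$ is stable if $\eta(v)\le 1$ and unstable otherwise; $\eta$ is stable if all vertices are stable. For $x\in\mathbb{Z}$, $\delta_x$ denotes the function equal to $1$ at $x$ and $0$ elsewhere. Fix $p\in(0,1)$. Let $(\xi_{x,i})_{x\in\mathbb{Z},i\in\mathbb{N}}$ be independent random toppling instructions with values in $\{\leftarrow,\rightarrow,\leftrightarrow,\varnothing\}$ and $\mathbb{P}(\xi_{x,i}=\leftarrow)=\mathbb{P}(\xi_{x,i}=\rightarrow)=p(1-p)$, $\mathbb{P}(\xi_{x,i}=\leftrightarrow)=p^2$, $\mathbb{P}(\xi_{x,i}=\varnothing)=(1-p)^2$.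 Applying an instruction at $x$ changes $\eta$ into: $\eta-\delta_x+\delta_{x-1}$ for $\leftarrow$; $\eta-\delta_x+\delta_{x+1}$ for $\rightarrow$; $\eta-2\delta_x+\delta_{x-1}+\delta_{x+1}$ for $\leftrightarrow$; $\eta$ for $\varnothing$. Stabilization of $n$ particles at the origin: set $\eta^{(n)}_0:=n\delta_0$ and $u_0:=0$ (the zero function on $\mathbb{Z}$). At time $k\in\mathbb{N}$, if $\eta^{(n)}_k$ is unstable, let $x_k$ be its leftmost unstable vertex, let $\eta^{(n)}_{k+1}$ be the result of applying the instruction $\xi_{x_k,u_k(x_k)}$ at $x_k$ to $\eta^{(n)}_k$, and set $u_{k+1}:=u_k+\delta_{x_k}$. If $\eta^{(n)}_k$ is stable, set $\eta^{(n)}_{k+1}:=\eta^{(n)}_k$ and $u_{k+1}:=u_k$. Let $K_n:=\inf\{k\in\mathbb{N}\mid \eta^{(n)}_k\text{ is stable}\}$, which is almost surely finite; the final stable configuration is $\eta^{(n)}:=\eta^{(n)}_{K_n}$ (defined almost surely). Boundary vertices: $\mathtt{l}_n:=\inf\{v\in\mathbb{Z}\mid\eta^{(n)}(v)>0\}$ and $\mathtt{r}_n:=\sup\{v\in\mathbb{Z}\mid\eta^{(n)}(v)>0\}$. Intervals $[a,b]$ with $a>b$ are empty. *)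

theory Defs
  imports "HOL-Probability.Probability"
begin

type_synonym config = "int \<Rightarrow> nat"

definition stable_vertex :: "config \<Rightarrow> int \<Rightarrow> bool" where
  "stable_vertex \<eta> v \<longleftrightarrow> \<eta> v \<le> 1"

definition stable :: "config \<Rightarrow> bool" where
  "stable \<eta> \<longleftrightarrow> (\<forall>v. stable_vertex \<eta> v)"

definition delta :: "int \<Rightarrow> config" where
  "delta x = (\<lambda>v. if v = x then 1 else 0)"

datatype instruction = ToLeft | ToRight | ToBoth | ToNone

primrec instruction_prob :: "real \<Rightarrow> instruction \<Rightarrow> real" where
  "instruction_prob p ToLeft = p * (1 - p)"
| "instruction_prob p ToRight = p * (1 - p)"
| "instruction_prob p ToBoth = p ^ 2"
| "instruction_prob p ToNone = (1 - p) ^ 2"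

text \<open>Subtraction on \<^typ>\<open>nat\<close> is truncated, but instructions are only ever applied at
  unstable vertices, which carry at least two particles, so no truncation occurs.\<close>

primrec apply_instruction :: "instruction \<Rightarrow> int \<Rightarrow> config \<Rightarrow> config" where
  "apply_instruction ToLeft x \<eta> = (\<lambda>v. \<eta> v - delta x v + delta (x - 1) v)"
| "apply_instruction ToRight x \<eta> = (\<lambda>v. \<eta> v - delta x v + delta (x + 1) v)"
| "apply_instruction ToBoth x \<eta> =
     (\<lambda>v. \<eta> v - 2 * delta x v + delta (x - 1) v + delta (x + 1) v)"
| "apply_instruction ToNone x \<eta> = \<eta>"

text \<open>Meaningful for unstable configurations with finitely many particles, where the
  set of unstable vertices is finite and nonempty.\<close>

definition leftmost_unstable :: "config \<Rightarrow> int" where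
  "leftmost_unstable \<eta> = (LEAST v. \<not> stable_vertex \<eta> v)"

text \<open>In the following, \<open>\<xi>\<close> is one realisation of the instructions, and the second component
  of a state is the odometer \<open>u\<close>, counting the instructions used so far at each vertex.\<close>

definition step ::
  "(int \<Rightarrow> nat \<Rightarrow> instruction) \<Rightarrow> config \<times> (int \<Rightarrow> nat) \<Rightarrow> config \<times> (int \<Rightarrow> nat)" where
  "step \<xi> s = (case s of (\<eta>, u) \<Rightarrow>
     if stable \<eta> then (\<eta>, u)
     else (let x = leftmost_unstable \<eta>
           in (apply_instruction (\<xi> x (u x)) x \<eta>, (\<lambda>v. u v + delta x v))))"

primrec state ::
  "(int \<Rightarrow> nat \<Rightarrow> instruction) \<Rightarrow> nat \<Rightarrow> nat \<Rightarrow> config \<times> (int \<Rightarrow> nat)" where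
  "state \<xi> n 0 = ((\<lambda>v. n * delta 0 v), (\<lambda>v. 0))"
| "state \<xi> n (Suc k) = step \<xi> (state \<xi> n k)"

definition config_at :: "(int \<Rightarrow> nat \<Rightarrow> instruction) \<Rightarrow> nat \<Rightarrow> nat \<Rightarrow> config" where
  "config_at \<xi> n k = fst (state \<xi> n k)"

text \<open>If no stable configuration is ever reached (an event of probability zero), this is the
  infimum of the empty set of naturals, a fixed but unspecified number, so that
  \<open>final_config\<close> takes an irrelevant value.\<close>

definition stab_time :: "(int \<Rightarrow> nat \<Rightarrow> instruction) \<Rightarrow> nat \<Rightarrow> nat" where
  "stab_time \<xi> n = Inf {k. stable (config_at \<xi> n k)}"

definition final_config :: "(int \<Rightarrow> nat \<Rightarrow> instruction) \<Rightarrow> nat \<Rightarrow> config" where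
  "final_config \<xi> n = config_at \<xi> n (stab_time \<xi> n)"

text \<open>For a configuration with a finite, nonzero number of particles, \<^const>\<open>Inf\<close> and
  \<^const>\<open>Sup\<close> on \<^typ>\<open>int\<close> are the minimum and maximum of the set of occupied vertices.\<close>

definition left_boundary :: "config \<Rightarrow> int" where
  "left_boundary \<eta> = Inf {v. \<eta> v > 0}"

definition right_boundary :: "config \<Rightarrow> int" where
  "right_boundary \<eta> = Sup {v. \<eta> v > 0}"

definition occupied_interval :: "(int \<Rightarrow> nat \<Rightarrow> instruction) \<Rightarrow> nat \<Rightarrow> int set" where
  "occupied_interval \<xi> n =
     {left_boundary (final_config \<xi> n)..right_boundary (final_config \<xi> n)}"

definition int_points :: "real \<Rightarrow> real \<Rightarrow> int set" where
  "int_points a b = {v. real_of_int v \<in> {a..b}}"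

end

theory Submission
  imports Defs
begin

text \<open>Call a configuration dense if every interval inside the hull of the visited sites carries at
  most one particle less than it has sites. Topplings preserve density, so the stable configuration
  occupies an interval of \<open>n\<close> or \<open>n + 1\<close> sites with at most one hole, and it remains to
  locate its centre. Let \<open>A = (\<Sum>v. v * \<eta> v)\<close> and \<open>B = (\<Sum>v. v\<^sup>2 * \<eta> v)\<close>. While \<open>\<eta>\<close> is unstable, each
  step raises the mean of \<open>A\<^sup>2\<close> by \<open>2 * p * (1 - p)\<close> and that of \<open>B\<close> by \<open>2 * p\<close>. Density forces
  \<open>B \<le> n\<^sup>3\<close>, which bounds the tail of the stabilization time and gives \<open>E A\<^sup>2 \<le> n\<^sup>3\<close>. By
  Chebyshev's inequality \<open>A\<close> is \<open>o(n\<^sup>2)\<close> in probability, hence the centre of the occupied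
  interval is \<open>o(n)\<close>. The bounds are applied at time \<open>k = n\<^sup>4\<close>.\<close>

section \<open>One instruction as a pair of 0/1 moves\<close>

primrec moves_left :: "instruction \<Rightarrow> nat" where
  "moves_left ToLeft = 1"
| "moves_left ToRight = 0"
| "moves_left ToBoth = 1"
| "moves_left ToNone = 0"

primrec moves_right :: "instruction \<Rightarrow> nat" where
  "moves_right ToLeft = 0"
| "moves_right ToRight = 1"
| "moves_right ToBoth = 1"
| "moves_right ToNone = 0"

lemma moves_le_1: "moves_left a \<le> 1" "moves_right a \<le> 1"
  by (cases a; simp)+

text \<open>With two particles at \<open>x\<close> the truncated subtractions are exact, so the
  effect becomes a linear formula in any commutative ring; it is needed over the integers for
  density and over the reals for moments.\<close>

lemma apply_instruction_of_nat:
  assumes "\<eta> x \<ge> 2"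
  shows "(of_nat (apply_instruction a x \<eta> v) :: 'b::comm_ring_1) =
    of_nat (\<eta> v) - (if v = x then of_nat (moves_left a + moves_right a) else 0)
      + (if v = x - 1 then of_nat (moves_left a) else 0)
      + (if v = x + 1 then of_nat (moves_right a) else 0)"
  using assms by (cases a) (auto simp: delta_def of_nat_diff)

lemma sum_apply_instruction:
  fixes f :: "int \<Rightarrow> 'b::comm_ring_1"
  assumes "\<eta> x \<ge> 2" and "finite I"
  shows "(\<Sum>v\<in>I. f v * of_nat (apply_instruction a x \<eta> v)) =
    (\<Sum>v\<in>I. f v * of_nat (\<eta> v))
      - (if x \<in> I then of_nat (moves_left a + moves_right a) * f x else 0)
      + (if x - 1 \<in> I then of_nat (moves_left a) * f (x - 1) else 0)
      + (if x + 1 \<in> I then of_nat (moves_right a) * f (x + 1) else 0)"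
proof -
  have *: "(\<Sum>v\<in>I. f v * (if v = y then c else 0)) = (if y \<in> I then c * f y else 0)"
    for y :: int and c :: 'b
    using assms(2) by (simp add: if_distrib mult.commute cong: if_cong)
  show ?thesis
    unfolding apply_instruction_of_nat[where \<eta> = \<eta> and x = x, OF assms(1)] distrib_left right_diff_distrib
      sum.distrib sum_subtractf * ..
qed

section \<open>Density and its preservation under topplings\<close>

text \<open>The interval from \<open>a\<close> to \<open>b\<close> has \<open>b - a + 1\<close>
  sites, so the last clause allows it one missing particle. The hull is kept as explicit parameters
  because its end sites may have been emptied again, so it cannot be recovered from
  \<open>\<eta>\<close>.\<close>

definition confined :: "nat \<Rightarrow> config \<Rightarrow> int \<Rightarrow> int \<Rightarrow> bool" where
  "confined n \<eta> L R \<longleftrightarrow> L \<le> 0 \<and> 0 \<le> R \<and> (\<forall>v. \<eta> v > 0 \<longrightarrow> L \<le> v \<and> v \<le> R) \<and>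
     (\<Sum>v=L..R. int (\<eta> v)) = int n \<and>
     (\<forall>a b. L \<le> a \<longrightarrow> b \<le> R \<longrightarrow> b - a \<le> (\<Sum>v=a..b. int (\<eta> v)))"

lemma confined_init: "confined n (\<lambda>v. n * delta 0 v) 0 0"
proof -
  have "b - a \<le> (\<Sum>v=a..b. int (n * delta 0 v))" if "0 \<le> a" "b \<le> 0" for a b :: int
  proof -
    have "0 \<le> (\<Sum>v=a..b. int (n * delta 0 v))" by (intro sum_nonneg) simp
    with that show ?thesis by linarith
  qed
  then show ?thesis
    by (auto simp: confined_def delta_def split: if_splits)
qed

lemma confined_apply:
  fixes a :: instruction
  assumes "confined n \<eta> L R" and x: "\<eta> x \<ge> 2"
  defines "L' \<equiv> if x = L \<and> moves_left a = 1 then L - 1 else L"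
    and "R' \<equiv> if x = R \<and> moves_right a = 1 then R + 1 else R"
  shows "confined n (apply_instruction a x \<eta>) L' R'"
proof -
  let ?S = "\<lambda>c d. \<Sum>v=c..d. int (\<eta> v)"
  let ?T = "\<lambda>c d. \<Sum>v=c..d. int (apply_instruction a x \<eta> v)"
  have L: "L \<le> 0" and R: "0 \<le> R" and supp: "\<And>v. \<eta> v > 0 \<Longrightarrow> L \<le> v \<and> v \<le> R"
    and total: "?S L R = int n"
    and dense: "\<And>c d. L \<le> c \<Longrightarrow> d \<le> R \<Longrightarrow> d - c \<le> ?S c d"
    using assms(1) by (auto simp: confined_def)
  have xLR: "L \<le> x" "x \<le> R" using supp[of x] x by auto
  have l: "moves_left a = 0 \<or> moves_left a = 1" and r: "moves_right a = 0 \<or> moves_right a = 1"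
    using moves_le_1[of a] by auto
  have T: "?T c d = ?S c d
      - (if c \<le> x \<and> x \<le> d then int (moves_left a + moves_right a) else 0)
      + (if c \<le> x - 1 \<and> x - 1 \<le> d then int (moves_left a) else 0)
      + (if c \<le> x + 1 \<and> x + 1 \<le> d then int (moves_right a) else 0)" for c d
    using sum_apply_instruction[where \<eta> = \<eta> and x = x and I = "{c..d}" and f = "\<lambda>_. 1::int" and a = a] x by simp
  have S_pos: "0 \<le> ?S c d" and T_pos: "0 \<le> ?T c d" for c d
    by (auto intro: sum_nonneg)
  have zero: "\<eta> v = 0" if "\<not> (L \<le> v \<and> v \<le> R)" for v
    using supp[of v] that by auto
  have S_hull: "?S L' R' = int n"
  proof -
    have "?S L' R' = ?S L R"
      by (rule sum.mono_neutral_right) (auto simp: L'_def R'_def zero)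
    with total show ?thesis by simp
  qed
  have total': "?T L' R' = int n"
    unfolding T S_hull using xLR l r by (auto simp: L'_def R'_def)
  have supp': "L' \<le> v \<and> v \<le> R'" if "apply_instruction a x \<eta> v > 0" for v
    using apply_instruction_of_nat[where \<eta> = \<eta> and x = x and a = a and v = v and 'b = int] x that supp[of v] xLR l r
    by (auto simp: L'_def R'_def split: if_splits)
  have dense': "d - c \<le> ?T c d" if cd: "L' \<le> c" "d \<le> R'" for c d
  proof -
    \<comment> \<open>For \<open>d \<le> c\<close> the required bound is not positive. Removing this
      case first ensures that an interval avoiding \<open>x\<close> lies in the old hull even if the
      hull has just grown: the new site alone is a singleton.\<close>
    consider "d \<le> c" | "c < d" "d < x" | "c < d" "x < c" | "c \<le> x" "x \<le> d" by linarith
    then show ?thesis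
    proof cases
      case 1
      with T_pos[of c d] show ?thesis by linarith
    next
      case 2
      then have "L \<le> c" "d \<le> R" using cd xLR by (auto simp: L'_def split: if_splits)
      from dense[OF this] 2 show ?thesis by (auto simp: T)
    next
      case 3
      then have "L \<le> c" "d \<le> R" using cd xLR by (auto simp: R'_def split: if_splits)
      from dense[OF this] 3 show ?thesis by (auto simp: T)
    next
      case 4
      let ?l = "int (moves_left a)" and ?r = "int (moves_right a)"
      have split: "?S c d = ?S c (x - 1) + int (\<eta> x) + ?S (x + 1) d"
      proof -
        have "{c..d} = insert x ({c..x - 1} \<union> {x + 1..d})" using 4 by auto
        then show ?thesis by (simp add: sum.union_disjoint)
      qed
      \<comment> \<open>If \<open>c = x\<close>, the left-hand side is \<open>?l - 1\<close>, which
        is at most 0. If \<open>c = L - 1\<close>, then \<open>x = L\<close> and the left part is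
        the single new site, for which nonnegativity suffices.\<close>
      have left: "x - 1 - c + ?l \<le> ?S c (x - 1) + (if c \<le> x - 1 then ?l else 0)"
        using dense[of c "x - 1"] S_pos[of c "x - 1"] 4 cd(1) xLR l
        by (auto simp: L'_def split: if_splits)
      have right: "d - (x + 1) + ?r \<le> ?S (x + 1) d + (if x + 1 \<le> d then ?r else 0)"
        using dense[of "x + 1" d] S_pos[of "x + 1" d] 4 cd(2) xLR r
        by (auto simp: R'_def split: if_splits)
      show ?thesis
        using left right x 4 unfolding T split by (simp split: if_splits)
    qed
  qed
  have "L' \<le> 0" "0 \<le> R'"
    using L R by (auto simp: L'_def R'_def)
  then show ?thesis
    unfolding confined_def using total' supp' dense' by simp
qed

lemma confined_bounds:
  assumes "confined n \<eta> L R"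
  shows "R - L \<le> int n" and "\<eta> v > 0 \<Longrightarrow> \<bar>v\<bar> \<le> int n"
proof -
  show "R - L \<le> int n" using assms unfolding confined_def by (metis order_refl)
  moreover assume "\<eta> v > 0"
  with assms have "L \<le> v" "v \<le> R" "L \<le> 0" "0 \<le> R" unfolding confined_def by auto
  ultimately show "\<bar>v\<bar> \<le> int n" by linarith
qed

section \<open>The dynamics as a recursion on finitely many states\<close>

text \<open>Making the instruction an argument of the step allows averaging over its law while the
  state is held fixed.\<close>

definition next_state :: "config \<times> (int \<Rightarrow> nat) \<Rightarrow> instruction \<Rightarrow> config \<times> (int \<Rightarrow> nat)" where
  "next_state s a = (if stable (fst s) then s
     else (apply_instruction a (leftmost_unstable (fst s)) (fst s),
           \<lambda>v. snd s v + delta (leftmost_unstable (fst s)) v))"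

definition next_index :: "config \<times> (int \<Rightarrow> nat) \<Rightarrow> int \<times> nat" where
  "next_index s = (leftmost_unstable (fst s), snd s (leftmost_unstable (fst s)))"

lemma state_Suc_next:
  "state \<xi> n (Suc k) = next_state (state \<xi> n k) (case_prod \<xi> (next_index (state \<xi> n k)))"
  by (simp add: step_def next_state_def next_index_def Let_def split: prod.splits)

text \<open>The integers are not well-ordered, so \<open>LEAST\<close> is meaningful only because
  confinement makes the set of unstable sites finite.\<close>

lemma leftmost_unstable_ge_2:
  assumes "confined n \<eta> L R" and "\<not> stable \<eta>"
  shows "\<eta> (leftmost_unstable \<eta>) \<ge> 2"
proof -
  let ?U = "{v. \<not> stable_vertex \<eta> v}"
  have "?U \<subseteq> {L..R}"
    using assms(1) by (force simp: confined_def stable_vertex_def)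
  then have fin: "finite ?U" by (rule finite_subset) simp
  have "?U \<noteq> {}" using assms(2) by (auto simp: stable_def)
  with fin have min: "Min ?U \<in> ?U" by (rule Min_in)
  then have "leftmost_unstable \<eta> = Min ?U"
    unfolding leftmost_unstable_def using fin by (intro Least_equality) auto
  with min show ?thesis by (auto simp: stable_vertex_def)
qed

lemma confined_next_state:
  assumes "confined n (fst s) L R"
  shows "\<exists>L R. confined n (fst (next_state s a)) L R"
  using assms confined_apply[OF assms leftmost_unstable_ge_2[OF assms]]
  by (auto simp: next_state_def)

text \<open>A finite deterministic range for the random state: it turns expectations into finite
  sums and makes integrability immediate.\<close>

primrec reachable :: "nat \<Rightarrow> nat \<Rightarrow> (config \<times> (int \<Rightarrow> nat)) set" where
  "reachable n 0 = {((\<lambda>v. n * delta 0 v), (\<lambda>v. 0))}"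
| "reachable n (Suc k) = (\<Union>s\<in>reachable n k. range (next_state s))"

lemma UNIV_instruction: "UNIV = {ToLeft, ToRight, ToBoth, ToNone}"
  using instruction.exhaust by blast

instance instruction :: finite
  by standard (simp add: UNIV_instruction)

lemma finite_reachable: "finite (reachable n k)"
  by (induction k) auto

lemma state_in_reachable: "state \<xi> n k \<in> reachable n k"
  by (induction k) (auto simp: state_Suc_next simp del: state.simps(2))

lemma confined_reachable: "s \<in> reachable n k \<Longrightarrow> \<exists>L R. confined n (fst s) L R"
proof (induction k arbitrary: s)
  case 0
  then show ?case using confined_init by auto
next
  case (Suc k)
  from Suc.prems obtain t a where t: "t \<in> reachable n k" and s: "s = next_state t a" by auto
  from Suc.IH[OF t] show ?case unfolding s using confined_next_state by blast
qed

lemma confined_state: "\<exists>L R. confined n (fst (state \<xi> n k)) L R"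
  by (rule confined_reachable[OF state_in_reachable])

text \<open>The first \<open>k\<close> steps read exactly the entries below the odometer reached, so
  other entries cannot influence the state. Only the odometer of one of the two runs appears, which
  lets the lemma be used from either side.\<close>

lemma state_cong:
  assumes "\<And>y i. i < snd (state \<xi> n k) y \<Longrightarrow> \<xi>' y i = \<xi> y i"
  shows "state \<xi>' n k = state \<xi> n k"
  using assms
proof (induction k)
  case 0
  then show ?case by simp
next
  case (Suc k)
  let ?s = "state \<xi> n k"
  have mono: "snd ?s y \<le> snd (state \<xi> n (Suc k)) y" for y
    by (simp add: state_Suc_next next_state_def del: state.simps)
  have IH: "state \<xi>' n k = ?s"
    using mono by (intro Suc.IH Suc.prems) (rule less_le_trans)
  show ?case
  proof (cases "stable (fst ?s)")
    case True
    then show ?thesis by (simp add: state_Suc_next next_state_def IH del: state.simps)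
  next
    case False
    then have "snd ?s (leftmost_unstable (fst ?s)) < snd (state \<xi> n (Suc k)) (leftmost_unstable (fst ?s))"
      by (simp add: state_Suc_next next_state_def delta_def del: state.simps)
    from Suc.prems[OF this] show ?thesis
      by (simp add: state_Suc_next next_index_def IH del: state.simps)
  qed
qed

text \<open>Which instruction is read next depends on the past. Fixing one of the finitely many
  earlier states makes its index deterministic, and the pieces are then glued together.\<close>

lemma measurable_state:
  assumes "\<And>x i. (\<lambda>\<omega>. \<xi> x i \<omega>) \<in> measurable N (count_space UNIV)"
  shows "(\<lambda>\<omega>. state (\<lambda>x i. \<xi> x i \<omega>) n k) \<in> measurable N (count_space (reachable n k))"
proof (induction k)
  case 0
  then show ?case by simp
next
  case (Suc k)
  have step: "(\<lambda>\<omega>. next_state s (case_prod (\<lambda>x i. \<xi> x i \<omega>) (next_index s)))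
      \<in> measurable N (count_space (reachable n (Suc k)))" if "s \<in> reachable n k" for s
  proof (rule measurable_compose[where g = "next_state s"])
    show "(\<lambda>\<omega>. case_prod (\<lambda>x i. \<xi> x i \<omega>) (next_index s)) \<in> measurable N (count_space UNIV)"
      using assms by (simp add: case_prod_beta)
    show "next_state s \<in> measurable (count_space UNIV) (count_space (reachable n (Suc k)))"
      using that by auto
  qed
  show ?case
    unfolding state_Suc_next
    by (rule measurable_compose_countable'[OF step Suc.IH])
       (auto intro: countable_finite finite_reachable)
qed

section \<open>Moments of a confined configuration\<close>

text \<open>\<open>A\<close> is the case \<open>j = 1\<close> and \<open>B\<close> the case
  \<open>j = 2\<close>. Particles stay within distance \<open>n\<close> of the origin; the extra
  site at each end keeps both neighbours of a toppled site inside the window.\<close>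

definition moment :: "nat \<Rightarrow> nat \<Rightarrow> config \<Rightarrow> real" where
  "moment n j \<eta> = (\<Sum>v=- int n - 1..int n + 1. real_of_int v ^ j * real (\<eta> v))"

lemma moment_apply:
  assumes "confined n \<eta> L R" and x: "\<eta> x \<ge> 2"
  shows "moment n j (apply_instruction a x \<eta>) = moment n j \<eta>
    + real (moves_left a) * (real_of_int (x - 1) ^ j - real_of_int x ^ j)
    + real (moves_right a) * (real_of_int (x + 1) ^ j - real_of_int x ^ j)"
proof -
  have "\<bar>x\<bar> \<le> int n" using confined_bounds(2)[OF assms(1)] x by simp
  then show ?thesis
    unfolding moment_def
    by (subst sum_apply_instruction[where \<eta> = \<eta> and x = x, OF x]) (auto simp: algebra_simps)
qed

lemma confined_sum_eq:
  assumes "confined n \<eta> L R" and "finite I" and "\<And>v. \<eta> v > 0 \<Longrightarrow> v \<in> I"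
  shows "(\<Sum>v\<in>I. int (\<eta> v)) = int n"
proof -
  have "(\<Sum>v\<in>I. int (\<eta> v)) = (\<Sum>v\<in>I \<union> {L..R}. int (\<eta> v))"
    using assms by (intro sum.mono_neutral_left) auto
  also have "\<dots> = (\<Sum>v=L..R. int (\<eta> v))"
    using assms by (intro sum.mono_neutral_right) (auto simp: confined_def)
  finally show ?thesis using assms(1) by (simp add: confined_def)
qed

lemma moment_2_le:
  assumes "confined n \<eta> L R"
  shows "moment n 2 \<eta> \<le> real n ^ 3"
proof -
  let ?I = "{- int n - 1..int n + 1}"
  have supp: "\<bar>v\<bar> \<le> int n" if "\<eta> v > 0" for v
    using confined_bounds(2)[OF assms that] .
  have "moment n 2 \<eta> \<le> (\<Sum>v\<in>?I. real n ^ 2 * real (\<eta> v))"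
    unfolding moment_def
  proof (rule sum_mono)
    fix v
    show "real_of_int v ^ 2 * real (\<eta> v) \<le> real n ^ 2 * real (\<eta> v)"
    proof (cases "\<eta> v > 0")
      case True
      have "real_of_int v ^ 2 \<le> real n ^ 2"
        using supp[OF True] by (intro power2_le_iff_abs_le[THEN iffD2]) auto
      then show ?thesis by (rule mult_right_mono) simp
    qed simp
  qed
  also have "\<dots> = real n ^ 2 * real_of_int (\<Sum>v\<in>?I. int (\<eta> v))"
    by (simp add: sum_distrib_left)
  also have "(\<Sum>v\<in>?I. int (\<eta> v)) = int n"
    by (rule confined_sum_eq[OF assms]) (auto dest!: supp)
  finally show ?thesis by (simp add: power2_eq_square power3_eq_cube)
qed

section \<open>Boundaries of a stable configuration\<close>

lemma two_sum_int_Icc: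
  fixes l r :: int
  assumes "l \<le> r"
  shows "2 * (\<Sum>v=l..r. v) = (l + r) * (r - l + 1)"
  using assms
proof (induction r rule: int_ge_induct)
  case (step r)
  have "{l..r + 1} = insert (r + 1) {l..r}" using step.hyps by auto
  with step.IH show ?case by (simp add: algebra_simps)
qed simp

text \<open>Stability forces at least \<open>n\<close> sites between \<open>l\<close> and
  \<open>r\<close>, density at most \<open>n + 1\<close>. Filling the possible hole turns
  \<open>A\<close> into the sum of an arithmetic progression, so \<open>2 * A\<close> equals
  \<open>n * (l + r)\<close> up to an error linear in \<open>n\<close>.\<close>

lemma stable_boundaries:
  assumes conf: "confined n \<eta> L R" and st: "stable \<eta>" and n: "n \<ge> 1"
  defines "l \<equiv> left_boundary \<eta>" and "r \<equiv> right_boundary \<eta>"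
  shows "int n - 1 \<le> r - l" and "r - l \<le> int n"
    and "real n * \<bar>real_of_int (l + r)\<bar> \<le> 2 * \<bar>moment n 1 \<eta>\<bar> + 4 * real n"
proof -
  let ?O = "{v. \<eta> v > 0}"
  have O: "?O \<subseteq> {L..R}" using conf by (auto simp: confined_def)
  then have fin: "finite ?O" by (rule finite_subset) simp
  have "?O \<noteq> {}"
  proof
    assume "?O = {}"
    then have "(\<Sum>v=L..R. int (\<eta> v)) = 0" by (intro sum.neutral) auto
    with conf n show False by (simp add: confined_def)
  qed
  with fin have l: "l = Min ?O" and r: "r = Max ?O" and lO: "l \<in> ?O" and rO: "r \<in> ?O"
    by (simp_all add: l_def r_def left_boundary_def right_boundary_def cInf_eq_Min cSup_eq_Max
        Min_in[OF fin, simplified] Max_in[OF fin, simplified])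
  have supp: "v \<in> {l..r}" if "\<eta> v > 0" for v
    using that fin by (auto simp: l r)
  have lr: "l \<le> r" using supp[of l] lO by simp
  have le1: "\<eta> v \<le> 1" for v using st by (auto simp: stable_def stable_vertex_def)
  have abs_le: "\<bar>v\<bar> \<le> int n" if "l \<le> v" "v \<le> r" for v
    using confined_bounds(2)[OF conf, of l] confined_bounds(2)[OF conf, of r] lO rO that by auto
  have total: "(\<Sum>v=l..r. int (\<eta> v)) = int n"
    using supp by (intro confined_sum_eq[OF conf]) auto
  have "int n \<le> (\<Sum>v=l..r. 1)"
    unfolding total[symmetric] using le1 by (intro sum_mono) (simp add: le1)
  then show lower: "int n - 1 \<le> r - l" using lr by simp
  show upper: "r - l \<le> int n"
    using conf O lO rO total unfolding confined_def by (metis atLeastAtMost_iff subsetD)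
  have "moment n 1 \<eta> = (\<Sum>v=l..r. real_of_int v * real (\<eta> v))"
    unfolding moment_def using abs_le supp by (intro sum.mono_neutral_cong_right) force+
  then have m: "moment n 1 \<eta> = real_of_int (\<Sum>v=l..r. v * int (\<eta> v))" by simp
  \<comment> \<open>\<open>d\<close> is the position of the hole, or 0 if there is none.\<close>
  define d where "d = (\<Sum>v=l..r. v * (1 - int (\<eta> v)))"
  have "\<bar>d\<bar> \<le> (\<Sum>v=l..r. \<bar>v * (1 - int (\<eta> v))\<bar>)" unfolding d_def by (rule sum_abs)
  also have "\<dots> \<le> (\<Sum>v=l..r. int n * (1 - int (\<eta> v)))"
    using abs_le le1 by (intro sum_mono) (auto simp: abs_mult intro!: mult_mono)
  also have "\<dots> = int n * (r - l + 1 - int n)"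
    using lr total by (simp add: sum_distrib_left[symmetric] sum_subtractf)
  also have "\<dots> \<le> int n * 1" using upper by (intro mult_left_mono) auto
  finally have d: "\<bar>d\<bar> \<le> int n" by simp
  have "(\<Sum>v=l..r. v * int (\<eta> v)) + d = (\<Sum>v=l..r. v)"
    by (simp add: d_def sum.distrib[symmetric] algebra_simps)
  \<comment> \<open>The factor \<open>r - l + 1 - int n\<close> is the number of holes. Its term and
    \<open>2 * d\<close> are each at most \<open>2 * n\<close> in absolute value, which gives the
    \<open>4 * n\<close> of the claim.\<close>
  then have eq: "int n * (l + r) = 2 * (\<Sum>v=l..r. v * int (\<eta> v)) + 2 * d
      - (r - l + 1 - int n) * (l + r)"
    using two_sum_int_Icc[OF lr] by (simp add: algebra_simps)
  have "\<bar>(r - l + 1 - int n) * (l + r)\<bar> \<le> 1 * (2 * int n)"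
    unfolding abs_mult using lower upper abs_le[of l] abs_le[of r] lr by (intro mult_mono) auto
  with eq d have "\<bar>int n * (l + r)\<bar> \<le> 2 * \<bar>\<Sum>v=l..r. v * int (\<eta> v)\<bar> + 4 * int n"
    by linarith
  then have "real_of_int \<bar>int n * (l + r)\<bar> \<le> real_of_int (2 * \<bar>\<Sum>v=l..r. v * int (\<eta> v)\<bar> + 4 * int n)"
    by (simp only: of_int_le_iff)
  then show "real n * \<bar>real_of_int (l + r)\<bar> \<le> 2 * \<bar>moment n 1 \<eta>\<bar> + 4 * real n"
    unfolding m by (simp add: abs_mult)
qed

section \<open>Reading the final configuration at a fixed time\<close>

lemma state_stable_mono:
  assumes "stable (config_at \<xi> n k)" and "k \<le> m"
  shows "state \<xi> n m = state \<xi> n k"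
  using assms(2,1)
  by (induction m rule: dec_induct) (auto simp: state_Suc_next next_state_def config_at_def simp del: state.simps(2))

text \<open>A stable state is frozen, so the random stabilization time can be replaced by any
  deterministic time by which the run has stabilized.\<close>

lemma final_config_eq:
  assumes "stable (config_at \<xi> n k)"
  shows "final_config \<xi> n = config_at \<xi> n k"
proof -
  have ne: "{k. stable (config_at \<xi> n k)} \<noteq> {}" using assms by auto
  have "stable (config_at \<xi> n (stab_time \<xi> n))"
    using Inf_nat_def1[OF ne] by (simp add: stab_time_def)
  moreover have "stab_time \<xi> n \<le> k"
    unfolding stab_time_def using assms by (intro cInf_lower) auto
  ultimately show ?thesis
    using state_stable_mono unfolding final_config_def config_at_def by metis
qed

lemma occupied_interval_if_small_moment:
  assumes st: "stable (config_at \<xi> n k)" and n: "n \<ge> 1" and \<epsilon>: "\<epsilon> > 0" "10 \<le> \<epsilon> * real n"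
    and A: "\<bar>moment n 1 (config_at \<xi> n k)\<bar> \<le> \<epsilon> / 4 * real n ^ 2"
  shows "int_points (- (real n / 2) * (1 - \<epsilon>)) (real n / 2 * (1 - \<epsilon>)) \<subseteq> occupied_interval \<xi> n"
    and "occupied_interval \<xi> n \<subseteq> int_points (- (real n / 2) * (1 + \<epsilon>)) (real n / 2 * (1 + \<epsilon>))"
proof -
  define l where "l = left_boundary (config_at \<xi> n k)"
  define r where "r = right_boundary (config_at \<xi> n k)"
  obtain L R where conf: "confined n (config_at \<xi> n k) L R"
    using confined_state unfolding config_at_def by blast
  note b = stable_boundaries[OF conf st n, folded l_def r_def]
  have I: "occupied_interval \<xi> n = {l..r}"
    by (simp add: occupied_interval_def final_config_eq[OF st] l_def r_def)
  have "real n * \<bar>real_of_int (l + r)\<bar> \<le> real n * (\<epsilon> / 2 * real n + 4)"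
    using b(3) A by (simp add: power2_eq_square algebra_simps)
  then have c: "\<bar>real_of_int (l + r)\<bar> \<le> \<epsilon> / 2 * real n + 4" using n by simp
  have w: "real n - 1 \<le> real_of_int r - real_of_int l" "real_of_int r - real_of_int l \<le> real n"
    using b(1,2) by linarith+
  \<comment> \<open>Writing \<open>2 * l\<close> and \<open>2 * r\<close> through
    \<open>l + r\<close> and \<open>r - l\<close> gives the error 4 from the centre plus 1 from the
    width; \<open>10 \<le> \<epsilon> * n\<close> absorbs both.\<close>
  have e: "\<epsilon> / 2 * real n + 5 \<le> \<epsilon> * real n" using \<epsilon>(2) by simp
  have "2 * real_of_int l \<le> - real n + \<epsilon> * real n" "real n - \<epsilon> * real n \<le> 2 * real_of_int r"
    "- real n - \<epsilon> * real n \<le> 2 * real_of_int l" "2 * real_of_int r \<le> real n + \<epsilon> * real n"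
    using c w e by (auto simp: abs_le_iff)
  then have bounds: "real_of_int l \<le> - (real n / 2) * (1 - \<epsilon>)" "real n / 2 * (1 - \<epsilon>) \<le> real_of_int r"
    "- (real n / 2) * (1 + \<epsilon>) \<le> real_of_int l" "real_of_int r \<le> real n / 2 * (1 + \<epsilon>)"
    by (simp_all add: field_simps)
  show "int_points (- (real n / 2) * (1 - \<epsilon>)) (real n / 2 * (1 - \<epsilon>)) \<subseteq> occupied_interval \<xi> n"
  proof
    fix v assume "v \<in> int_points (- (real n / 2) * (1 - \<epsilon>)) (real n / 2 * (1 - \<epsilon>))"
    then have "real_of_int l \<le> real_of_int v" "real_of_int v \<le> real_of_int r"
      using bounds by (auto simp: int_points_def)
    then show "v \<in> occupied_interval \<xi> n" by (simp add: I)
  qed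
  show "occupied_interval \<xi> n \<subseteq> int_points (- (real n / 2) * (1 + \<epsilon>)) (real n / 2 * (1 + \<epsilon>))"
  proof
    fix v assume "v \<in> occupied_interval \<xi> n"
    then have "real_of_int l \<le> real_of_int v" "real_of_int v \<le> real_of_int r"
      by (simp_all add: I)
    then show "v \<in> int_points (- (real n / 2) * (1 + \<epsilon>)) (real n / 2 * (1 + \<epsilon>))"
      using bounds by (auto simp: int_points_def)
  qed
qed

section \<open>Mean one-step increments\<close>

lemma sum_instruction: "(\<Sum>a\<in>UNIV. f a) = f ToLeft + f ToRight + f ToBoth + f ToNone"
  for f :: "instruction \<Rightarrow> real"
  unfolding UNIV_instruction by simp

text \<open>A move to either side has probability \<open>p\<close>, and the two increments
  \<open>1 - 2 * x\<close> and \<open>1 + 2 * x\<close> of \<open>B\<close> add up to 2.\<close>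

lemma mean_moment_2_next:
  assumes "s \<in> reachable n k"
  shows "(\<Sum>a\<in>UNIV. instruction_prob p a * moment n 2 (fst (next_state s a))) =
    moment n 2 (fst s) + 2 * p * (if stable (fst s) then 0 else 1)"
proof -
  obtain L R where conf: "confined n (fst s) L R" using confined_reachable[OF assms] by blast
  show ?thesis
  proof (cases "stable (fst s)")
    case True
    then show ?thesis by (simp add: next_state_def sum_instruction algebra_simps power2_eq_square)
  next
    case False
    show ?thesis
      using False
      by (simp add: next_state_def sum_instruction moment_apply[OF conf leftmost_unstable_ge_2[OF conf False]])
        algebra
  qed
qed

text \<open>Under the law of an instruction the left and right moves are independent Bernoulli
  variables with parameter \<open>p\<close>. Hence the increment of \<open>A\<close> has mean 0 and
  variance \<open>2 * p * (1 - p)\<close>.\<close>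

lemma mean_moment_1_square_next:
  assumes "s \<in> reachable n k"
  shows "(\<Sum>a\<in>UNIV. instruction_prob p a * moment n 1 (fst (next_state s a)) ^ 2) =
    moment n 1 (fst s) ^ 2 + 2 * p * (1 - p) * (if stable (fst s) then 0 else 1)"
proof -
  obtain L R where conf: "confined n (fst s) L R" using confined_reachable[OF assms] by blast
  show ?thesis
  proof (cases "stable (fst s)")
    case True
    then show ?thesis by (simp add: next_state_def sum_instruction algebra_simps power2_eq_square)
  next
    case False
    show ?thesis
      using False
      by (simp add: next_state_def sum_instruction moment_apply[OF conf leftmost_unstable_ge_2[OF conf False]])
        algebra
  qed
qed

lemma (in prob_space) expectation_sum_indicator:
  fixes c :: "'i \<Rightarrow> real"
  assumes "\<And>i. i \<in> I \<Longrightarrow> E i \<in> events"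
  shows "expectation (\<lambda>\<omega>. \<Sum>i\<in>I. c i * indicator (E i) \<omega>) = (\<Sum>i\<in>I. c i * prob (E i))"
  using assms by (subst Bochner_Integration.integral_sum) (auto simp: less_top[symmetric])

section \<open>Independence of the next instruction from the past\<close>

locale random_instructions = prob_space M for M :: "'a measure" +
  fixes \<xi> :: "int \<Rightarrow> nat \<Rightarrow> 'a \<Rightarrow> instruction" and p :: real
  assumes p: "0 < p" "p < 1"
    and indep: "indep_vars (\<lambda>_. count_space UNIV) (\<lambda>(x, i). \<xi> x i) UNIV"
    and law: "\<And>x i a. prob {\<omega> \<in> space M. \<xi> x i \<omega> = a} = instruction_prob p a"
begin

abbreviation S :: "nat \<Rightarrow> nat \<Rightarrow> 'a \<Rightarrow> config \<times> (int \<Rightarrow> nat)" where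
  "S n k \<omega> \<equiv> state (\<lambda>x i. \<xi> x i \<omega>) n k"

lemma measurable_instruction: "\<xi> x i \<in> measurable M (count_space UNIV)"
  using indep_vars_def[THEN iffD1, OF indep] by (auto dest: bspec[where x = "(x, i)"])

lemma measurable_S: "S n k \<in> measurable M (count_space (reachable n k))"
  by (rule measurable_state) (rule measurable_instruction)

lemma sets_S: "{\<omega> \<in> space M. P (S n k \<omega>)} \<in> events"
proof -
  have "S n k -` {s \<in> reachable n k. P s} \<inter> space M \<in> events"
    by (rule measurable_sets[OF measurable_S]) auto
  moreover have "S n k -` {s \<in> reachable n k. P s} \<inter> space M = {\<omega> \<in> space M. P (S n k \<omega>)}"
    using state_in_reachable by auto
  ultimately show ?thesis by simp
qed

lemma sets_instruction: "{\<omega> \<in> space M. case_prod \<xi> j \<omega> = a} \<in> events"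
proof -
  have "case_prod \<xi> j -` {a} \<inter> space M \<in> events"
    using measurable_instruction by (intro measurable_sets[where A = "count_space UNIV"]) (auto split: prod.split)
  then show ?thesis by (simp add: vimage_def Int_def conj_commute)
qed

lemma integrable_S: "integrable M (\<lambda>\<omega>. F (S n k \<omega>) :: real)"
proof (rule integrable_const_bound)
  show "AE \<omega> in M. norm (F (S n k \<omega>)) \<le> Max ((\<lambda>s. \<bar>F s\<bar>) ` reachable n k)"
    using finite_reachable state_in_reachable by (intro AE_I2) auto
  show "(\<lambda>\<omega>. F (S n k \<omega>)) \<in> borel_measurable M"
    by (rule measurable_compose[OF measurable_S]) simp
qed

text \<open>The event that the \<open>k\<close>-th state is \<open>s\<close> only involves instructions below the odometer of \<open>s\<close>,
  so the next instruction to be used is still fresh.\<close>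

lemma prob_next_instruction:
  "prob {\<omega> \<in> space M. S n k \<omega> = s \<and> case_prod \<xi> (next_index s) \<omega> = a}
    = prob {\<omega> \<in> space M. S n k \<omega> = s} * instruction_prob p a"
proof -
  let ?U = "{j :: int \<times> nat. snd j < snd s (fst j)}" and ?j = "next_index s"
  let ?P = "\<lambda>A. PiM A (\<lambda>_ :: int \<times> nat. count_space (UNIV :: instruction set))"
  \<comment> \<open>The default \<open>ToNone\<close> completes a partial field of instructions; it
    is never read in a run whose state at time \<open>k\<close> is \<open>s\<close>.\<close>
  let ?ext = "\<lambda>f x i. if (x, i) \<in> ?U then f (x, i) else ToNone"
  let ?A = "{f \<in> space (?P ?U). state (?ext f) n k = s}"
  let ?B = "{f \<in> space (?P {?j}). f ?j = a}"
  let ?X = "\<lambda>\<omega>. restrict (\<lambda>j. case_prod \<xi> j \<omega>) ?U"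
  let ?Y = "\<lambda>\<omega>. restrict (\<lambda>j. case_prod \<xi> j \<omega>) {?j}"
  \<comment> \<open>The next index equals the odometer at its site, whereas \<open>?U\<close>
    demands a strictly smaller one.\<close>
  have "?j \<notin> ?U" by (simp add: next_index_def)
  then have ind: "indep_var (?P ?U) ?X (?P {?j}) ?Y"
    by (intro indep_var_restrict[OF indep]) auto
  have "(\<lambda>f. state (?ext f) n k) \<in> measurable (?P ?U) (count_space (reachable n k))"
  proof (rule measurable_state)
    show "(\<lambda>f. ?ext f x i) \<in> measurable (?P ?U) (count_space UNIV)" for x i
      by (cases "(x, i) \<in> ?U") (simp_all add: measurable_component_singleton)
  qed
  from measurable_sets[OF this, of "{s} \<inter> reachable n k"]
  have "(\<lambda>f. state (?ext f) n k) -` ({s} \<inter> reachable n k) \<inter> space (?P ?U) \<in> sets (?P ?U)" by simp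
  also have "(\<lambda>f. state (?ext f) n k) -` ({s} \<inter> reachable n k) \<inter> space (?P ?U) = ?A"
    using state_in_reachable by auto
  finally have A: "?A \<in> sets (?P ?U)" .
  have "(\<lambda>f. f ?j) -` {a} \<inter> space (?P {?j}) \<in> sets (?P {?j})"
    by (rule measurable_sets[OF measurable_component_singleton]) auto
  also have "(\<lambda>f. f ?j) -` {a} \<inter> space (?P {?j}) = ?B" by auto
  finally have B: "?B \<in> sets (?P {?j})" .
  \<comment> \<open>Whichever of the two runs is known to end in \<open>s\<close> has the odometer
    of \<open>s\<close>, below which the two fields agree.\<close>
  have "S n k \<omega> = s \<longleftrightarrow> state (?ext (?X \<omega>)) n k = s" for \<omega>
  proof
    assume "S n k \<omega> = s"
    then have "state (?ext (?X \<omega>)) n k = S n k \<omega>" by (intro state_cong) auto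
    with \<open>S n k \<omega> = s\<close> show "state (?ext (?X \<omega>)) n k = s" by simp
  next
    assume s: "state (?ext (?X \<omega>)) n k = s"
    then have "S n k \<omega> = state (?ext (?X \<omega>)) n k" by (intro state_cong) auto
    with s show "S n k \<omega> = s" by simp
  qed
  then have X: "?X -` ?A \<inter> space M = {\<omega> \<in> space M. S n k \<omega> = s}"
    by (auto simp: space_PiM PiE_def extensional_def)
  have Y: "?Y -` ?B \<inter> space M = {\<omega> \<in> space M. case_prod \<xi> ?j \<omega> = a}"
    by (auto simp: space_PiM PiE_def extensional_def)
  have "(\<lambda>\<omega>. (?X \<omega>, ?Y \<omega>)) -` (?A \<times> ?B) \<inter> space M = (?X -` ?A \<inter> space M) \<inter> (?Y -` ?B \<inter> space M)"
    by auto
  also have "\<dots> = {\<omega> \<in> space M. S n k \<omega> = s \<and> case_prod \<xi> ?j \<omega> = a}"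
    unfolding X Y by auto
  finally have "prob {\<omega> \<in> space M. S n k \<omega> = s \<and> case_prod \<xi> ?j \<omega> = a}
      = prob {\<omega> \<in> space M. S n k \<omega> = s} * prob {\<omega> \<in> space M. case_prod \<xi> ?j \<omega> = a}"
    using indep_varD[OF ind A B] unfolding X Y by simp
  then show ?thesis using law by (simp add: case_prod_beta)
qed

lemma expectation_S:
  "expectation (\<lambda>\<omega>. F (S n k \<omega>) :: real)
    = (\<Sum>s\<in>reachable n k. F s * prob {\<omega> \<in> space M. S n k \<omega> = s})"
proof -
  have "F (S n k \<omega>) = (\<Sum>s\<in>reachable n k. F s * indicator {\<omega> \<in> space M. S n k \<omega> = s} \<omega>)"
    if "\<omega> \<in> space M" for \<omega>
  proof -
    have "(\<Sum>s\<in>reachable n k. F s * indicator {\<omega> \<in> space M. S n k \<omega> = s} \<omega>)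
        = (\<Sum>s\<in>reachable n k. if S n k \<omega> = s then F s else 0)"
      using that by (intro sum.cong) auto
    then show ?thesis by (simp add: finite_reachable state_in_reachable)
  qed
  then have "expectation (\<lambda>\<omega>. F (S n k \<omega>))
      = expectation (\<lambda>\<omega>. \<Sum>s\<in>reachable n k. F s * indicator {\<omega> \<in> space M. S n k \<omega> = s} \<omega>)"
    by (intro Bochner_Integration.integral_cong) auto
  also have "\<dots> = (\<Sum>s\<in>reachable n k. F s * prob {\<omega> \<in> space M. S n k \<omega> = s})"
    by (rule expectation_sum_indicator) (rule sets_S)
  finally show ?thesis .
qed

text \<open>This is the Markov property in averaged form: splitting over the current state and the
  instruction read next, the weights factorize by \<open>prob_next_instruction\<close>.\<close>

lemma expectation_S_Suc:
  fixes F :: "config \<times> (int \<Rightarrow> nat) \<Rightarrow> real"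
  shows "expectation (\<lambda>\<omega>. F (S n (Suc k) \<omega>))
    = expectation (\<lambda>\<omega>. \<Sum>a\<in>UNIV. instruction_prob p a * F (next_state (S n k \<omega>) a))"
proof -
  let ?E = "\<lambda>(s, a). {\<omega> \<in> space M. S n k \<omega> = s \<and> case_prod \<xi> (next_index s) \<omega> = a}"
  let ?I = "reachable n k \<times> (UNIV :: instruction set)"
  have E: "?E (s, a) \<in> events" for s a
  proof -
    have "?E (s, a) = {\<omega> \<in> space M. S n k \<omega> = s} \<inter> {\<omega> \<in> space M. case_prod \<xi> (next_index s) \<omega> = a}"
      by auto
    then show ?thesis using sets_S sets_instruction by auto
  qed
  have "F (S n (Suc k) \<omega>) = (\<Sum>i\<in>?I. F (case_prod next_state i) * indicator (?E i) \<omega>)"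
    if "\<omega> \<in> space M" for \<omega>
  proof -
    define i where "i = (S n k \<omega>, case_prod (\<lambda>x i. \<xi> x i \<omega>) (next_index (S n k \<omega>)))"
    have "(\<Sum>j\<in>?I. F (case_prod next_state j) * indicator (?E j) \<omega>)
        = (\<Sum>j\<in>?I. if i = j then F (case_prod next_state j) else 0)"
      using that by (intro sum.cong) (auto simp: i_def indicator_def split: prod.splits)
    also have "\<dots> = F (case_prod next_state i)"
      by (simp add: finite_reachable state_in_reachable i_def)
    finally show ?thesis by (simp add: i_def state_Suc_next del: state.simps)
  qed
  then have "expectation (\<lambda>\<omega>. F (S n (Suc k) \<omega>))
      = expectation (\<lambda>\<omega>. \<Sum>i\<in>?I. F (case_prod next_state i) * indicator (?E i) \<omega>)"
    by (intro Bochner_Integration.integral_cong) auto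
  also have "\<dots> = (\<Sum>i\<in>?I. F (case_prod next_state i) * prob (?E i))"
    using E by (intro expectation_sum_indicator) auto
  also have "\<dots> = (\<Sum>(s, a)\<in>?I. F (next_state s a)
      * (prob {\<omega> \<in> space M. S n k \<omega> = s} * instruction_prob p a))"
    by (intro sum.cong) (auto simp: prob_next_instruction)
  also have "\<dots> = (\<Sum>s\<in>reachable n k. (\<Sum>a\<in>UNIV. instruction_prob p a * F (next_state s a))
      * prob {\<omega> \<in> space M. S n k \<omega> = s})"
    by (simp add: sum.cartesian_product[symmetric] sum_distrib_right mult_ac)
  finally show ?thesis
    using expectation_S[where F = "\<lambda>s. \<Sum>a\<in>UNIV. instruction_prob p a * F (next_state s a)"]
    by simp
qed

section \<open>Bounds on instability and on the first moment\<close>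

definition unstable_prob :: "nat \<Rightarrow> nat \<Rightarrow> real" where
  "unstable_prob n k = prob {\<omega> \<in> space M. \<not> stable (fst (S n k \<omega>))}"

lemma unstable_prob_eq:
  "unstable_prob n k = expectation (\<lambda>\<omega>. if stable (fst (S n k \<omega>)) then 0 else 1)"
proof -
  have "expectation (\<lambda>\<omega>. if stable (fst (S n k \<omega>)) then 0 else 1 :: real)
      = expectation (indicator {\<omega> \<in> space M. \<not> stable (fst (S n k \<omega>))})"
    by (intro Bochner_Integration.integral_cong) auto
  also have "\<dots> = unstable_prob n k"
    by (auto simp: unstable_prob_def intro!: arg_cong[where f = prob])
  finally show ?thesis by simp
qed

lemma unstable_prob_antimono:
  assumes "j \<le> k"
  shows "unstable_prob n k \<le> unstable_prob n j"
  unfolding unstable_prob_def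
proof (rule finite_measure_mono)
  show "{\<omega> \<in> space M. \<not> stable (fst (S n k \<omega>))} \<subseteq> {\<omega> \<in> space M. \<not> stable (fst (S n j \<omega>))}"
    using state_stable_mono[OF _ assms] by (auto simp: config_at_def)
qed (rule sets_S)

lemma expectation_S_drift:
  fixes F :: "config \<times> (int \<Rightarrow> nat) \<Rightarrow> real"
  assumes "\<And>s. s \<in> reachable n k \<Longrightarrow> (\<Sum>a\<in>UNIV. instruction_prob p a * F (next_state s a))
      = F s + c * (if stable (fst s) then 0 else 1)"
  shows "expectation (\<lambda>\<omega>. F (S n (Suc k) \<omega>)) = expectation (\<lambda>\<omega>. F (S n k \<omega>)) + c * unstable_prob n k"
proof -
  have "expectation (\<lambda>\<omega>. F (S n (Suc k) \<omega>))
      = expectation (\<lambda>\<omega>. F (S n k \<omega>) + c * (if stable (fst (S n k \<omega>)) then 0 else 1))"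
    unfolding expectation_S_Suc using assms[OF state_in_reachable] by simp
  also have "\<dots> = expectation (\<lambda>\<omega>. F (S n k \<omega>)) + c * unstable_prob n k"
    unfolding unstable_prob_eq
    by (subst Bochner_Integration.integral_add[OF integrable_S[of F] integrable_S]) simp
  finally show ?thesis .
qed

abbreviation EA :: "nat \<Rightarrow> nat \<Rightarrow> real" where
  "EA n k \<equiv> expectation (\<lambda>\<omega>. moment n 1 (fst (S n k \<omega>)) ^ 2)"

abbreviation EB :: "nat \<Rightarrow> nat \<Rightarrow> real" where
  "EB n k \<equiv> expectation (\<lambda>\<omega>. moment n 2 (fst (S n k \<omega>)))"

lemma moment_init: "j > 0 \<Longrightarrow> moment n j (\<lambda>v. n * delta 0 v) = 0"
  unfolding moment_def by (intro sum.neutral) (auto simp: delta_def)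

lemma EB_Suc: "EB n (Suc k) = EB n k + 2 * p * unstable_prob n k"
  by (rule expectation_S_drift) (rule mean_moment_2_next)

text \<open>Both means start at 0 and grow by multiples of the same probabilities
  \<open>unstable_prob n k\<close>, with ratio \<open>1 - p\<close>. A bound on \<open>B\<close>
  therefore controls the variance of \<open>A\<close> without any estimate of the stabilization
  time.\<close>

lemma EA_eq: "EA n k = (1 - p) * EB n k"
proof (induction k)
  case (Suc k)
  have "EA n (Suc k) = EA n k + 2 * p * (1 - p) * unstable_prob n k"
    by (rule expectation_S_drift) (rule mean_moment_1_square_next)
  with Suc EB_Suc show ?case by (simp add: algebra_simps)
qed (simp add: moment_init)

lemma EB_le: "EB n k \<le> real n ^ 3"
proof -
  have "moment n 2 (fst (S n k \<omega>)) \<le> real n ^ 3" for \<omega>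
    using confined_state[of n "\<lambda>x i. \<xi> x i \<omega>" k] moment_2_le by blast
  then have "EB n k \<le> expectation (\<lambda>_. real n ^ 3)"
    by (intro integral_mono integrable_S[of "\<lambda>s. moment n 2 (fst s)"]) auto
  then show ?thesis by (simp add: prob_space)
qed

text \<open>Each of the first \<open>k\<close> steps adds to the mean of \<open>B\<close> at least
  \<open>2 * p\<close> times the instability probability at time \<open>k\<close>, since that
  probability decreases in time; the total is capped by \<open>n ^ 3\<close>.\<close>

lemma unstable_prob_le: "2 * p * (real k * unstable_prob n k) \<le> real n ^ 3"
proof -
  have "2 * p * (real j * unstable_prob n k) \<le> EB n j" if "j \<le> k" for j
    using that
  proof (induction j)
    case (Suc j)
    have "2 * p * unstable_prob n k \<le> 2 * p * unstable_prob n j"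
      using Suc.prems p by (intro mult_left_mono unstable_prob_antimono) auto
    with Suc show ?case unfolding EB_Suc by (simp add: algebra_simps)
  qed (simp add: moment_init)
  from this[of k] EB_le[of n k] show ?thesis by linarith
qed

lemma deviation_prob_le:
  assumes "t > 0"
  shows "prob {\<omega> \<in> space M. \<bar>moment n 1 (fst (S n k \<omega>))\<bar> \<ge> t} \<le> real n ^ 3 / t ^ 2"
proof -
  have "{\<omega> \<in> space M. \<bar>moment n 1 (fst (S n k \<omega>))\<bar> \<ge> t}
      = {\<omega> \<in> space M. moment n 1 (fst (S n k \<omega>)) ^ 2 \<ge> t ^ 2}"
    using assms by (simp add: abs_le_square_iff[of t, symmetric])
  also have "prob \<dots> \<le> EA n k / t ^ 2"
    using assms by (intro integral_Markov_inequality_measure[where A = "{}"]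
        integrable_S[of "\<lambda>s. moment n 1 (fst s) ^ 2"]) auto
  also have "EA n k \<le> EB n k"
  proof -
    have "EB n k \<ge> 0" by (rule Bochner_Integration.integral_nonneg) (simp add: moment_def sum_nonneg)
    then show ?thesis unfolding EA_eq using p by (simp add: mult_left_le_one_le)
  qed
  finally show ?thesis using EB_le[of n k] by (simp add: divide_right_mono order_trans)
qed

section \<open>The typical event and the limit\<close>

definition typical :: "real \<Rightarrow> nat \<Rightarrow> 'a set" where
  "typical \<epsilon> n = {\<omega> \<in> space M.
     int_points (- (real n / 2) * (1 - \<epsilon>)) (real n / 2 * (1 - \<epsilon>))
       \<subseteq> occupied_interval (\<lambda>x i. \<xi> x i \<omega>) n \<and>
     occupied_interval (\<lambda>x i. \<xi> x i \<omega>) n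
       \<subseteq> int_points (- (real n / 2) * (1 + \<epsilon>)) (real n / 2 * (1 + \<epsilon>))}"

lemma sets_final_config: "{\<omega> \<in> space M. P (final_config (\<lambda>x i. \<xi> x i \<omega>) n)} \<in> events"
proof -
  \<comment> \<open>A run that never stabilizes is read at the fixed time \<open>Inf {}\<close>, so
    this exceptional case is measurable as well and the event is a countable combination of events
    about \<open>S n k\<close>.\<close>
  have eq: "P (final_config (\<lambda>x i. \<xi> x i \<omega>) n) \<longleftrightarrow>
      (\<exists>k. stable (fst (S n k \<omega>)) \<and> P (fst (S n k \<omega>))) \<or>
      (\<forall>k. \<not> stable (fst (S n k \<omega>))) \<and> P (fst (S n (Inf {}) \<omega>))" for \<omega>
  proof (cases "\<exists>k. stable (fst (S n k \<omega>))")
    case True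
    then show ?thesis using final_config_eq[of "\<lambda>x i. \<xi> x i \<omega>" n] unfolding config_at_def by metis
  next
    case False
    then have "stab_time (\<lambda>x i. \<xi> x i \<omega>) n = Inf {}"
      by (simp add: stab_time_def config_at_def)
    with False show ?thesis by (simp add: final_config_def config_at_def)
  qed
  show ?thesis
    unfolding eq
    by (intro sets.sets_Collect sets_S[of "\<lambda>s. stable (fst s)"] sets_S[of "\<lambda>s. P (fst s)"] sets_S)
qed

lemma prob_typical_ge:
  assumes n: "n \<ge> 1" and \<epsilon>: "\<epsilon> > 0" "10 \<le> \<epsilon> * real n"
  shows "1 - (1 / (2 * p) + 16 / \<epsilon> ^ 2) / real n \<le> prob (typical \<epsilon> n)"
proof -
  \<comment> \<open>The instability bound \<open>n ^ 3 / (2 * p * k)\<close> becomes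
    \<open>1 / (2 * p * n)\<close>. With the threshold \<open>t\<close> that the geometric lemma
    demands, Chebyshev's bound \<open>n ^ 3 / t ^ 2\<close> is also of order
    \<open>1 / n\<close>.\<close>
  define k where "k = n ^ 4"
  define t where "t = \<epsilon> / 4 * real n ^ 2"
  have t: "t > 0" using n \<epsilon> by (simp add: t_def)
  let ?U = "{\<omega> \<in> space M. \<not> stable (fst (S n k \<omega>))}"
  let ?D = "{\<omega> \<in> space M. \<bar>moment n 1 (fst (S n k \<omega>))\<bar> \<ge> t}"
  have sets: "?U \<in> events" "?D \<in> events"
    by (rule sets_S)+
  have bal: "typical \<epsilon> n \<in> events"
    unfolding typical_def occupied_interval_def by (rule sets_final_config)
  \<comment> \<open>Outside \<open>?U\<close> and \<open>?D\<close> the run is stable at time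
    \<open>k\<close> with a small first moment, so the geometric lemma applies.\<close>
  have "space M - typical \<epsilon> n \<subseteq> ?U \<union> ?D"
    using occupied_interval_if_small_moment[OF _ n \<epsilon>, of _ k, folded t_def]
    by (force simp: typical_def config_at_def)
  then have "prob (space M - typical \<epsilon> n) \<le> prob (?U \<union> ?D)"
    using sets by (intro finite_measure_mono) auto
  also have "\<dots> \<le> prob ?U + prob ?D" using sets by (intro measure_Un_le)
  also have "prob ?U \<le> 1 / (2 * p) / real n"
  proof -
    have "2 * p * real n ^ 4 * prob ?U \<le> real n ^ 3"
      using unstable_prob_le[of k n] by (simp add: k_def unstable_prob_def mult_ac)
    then show ?thesis using p n by (simp add: field_simps power3_eq_cube power4_eq_xxxx)
  qed
  also have "prob ?D \<le> 16 / \<epsilon> ^ 2 / real n"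
  proof -
    have "real n ^ 3 / t ^ 2 = 16 / \<epsilon> ^ 2 / real n"
      using n \<epsilon> by (simp add: t_def field_simps power2_eq_square power3_eq_cube)
    with deviation_prob_le[OF t, of n k] show ?thesis by simp
  qed
  finally show ?thesis using prob_compl[OF bal] by (simp add: add_divide_distrib)
qed

lemma prob_typical_tendsto:
  assumes "\<epsilon> > 0"
  shows "(\<lambda>n. prob (typical \<epsilon> n)) \<longlonglongrightarrow> 1"
proof (rule tendsto_sandwich)
  let ?c = "1 / (2 * p) + 16 / \<epsilon> ^ 2"
  have "(\<lambda>n. 1 - ?c / real n) \<longlonglongrightarrow> 1 - 0"
    by (intro tendsto_diff tendsto_const lim_const_over_n)
  then show "(\<lambda>n. 1 - ?c / real n) \<longlonglongrightarrow> 1" by simp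
  show "\<forall>\<^sub>F n in sequentially. 1 - ?c / real n \<le> prob (typical \<epsilon> n)"
    using eventually_ge_at_top[of "nat \<lceil>10 / \<epsilon>\<rceil>"] eventually_ge_at_top[of 1]
  proof eventually_elim
    case (elim n)
    then have "10 / \<epsilon> \<le> real n" by linarith
    then have "10 \<le> \<epsilon> * real n" using assms by (simp add: field_simps)
    with elim assms show ?case by (intro prob_typical_ge)
  qed
  show "\<forall>\<^sub>F n in sequentially. prob (typical \<epsilon> n) \<le> 1"
    by (simp add: prob_le_1)
qed simp

end

theorem theorem1p1:
  fixes M :: "'a measure"
    and \<xi> :: "int \<Rightarrow> nat \<Rightarrow> 'a \<Rightarrow> instruction"
    and p :: real
  assumes "0 < p" and "p < 1"
    and "prob_space M"
    and "prob_space.indep_vars M (\<lambda>_. count_space UNIV) (\<lambda>(x, i). \<xi> x i) UNIV"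
    and "\<And>x i a. measure M {\<omega> \<in> space M. \<xi> x i \<omega> = a} = instruction_prob p a"
  shows "\<forall>\<epsilon>>0.
    (\<lambda>n::nat. measure M {\<omega> \<in> space M.
        int_points (- (real n / 2) * (1 - \<epsilon>)) (real n / 2 * (1 - \<epsilon>))
          \<subseteq> occupied_interval (\<lambda>x i. \<xi> x i \<omega>) n \<and>
        occupied_interval (\<lambda>x i. \<xi> x i \<omega>) n
          \<subseteq> int_points (- (real n / 2) * (1 + \<epsilon>)) (real n / 2 * (1 + \<epsilon>))})
      \<longlonglongrightarrow> 1"
proof -
  interpret random_instructions M \<xi> p
    using assms by (simp add: random_instructions_def random_instructions_axioms_def)
  show ?thesis
    using prob_typical_tendsto unfolding typical_def by blast
qed

end
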